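(* Let $m$ be a non-negative integer and $\alpha>0$. For $z\in\mathbb{C}$ with $|z|<1$, $$\big(C_m^{(\alpha)}(1-2z)\big)^3=\Big(\frac{(2\alpha)_m}{m!}\Big)^3F^3\left(-m,m+2\alpha;\alpha+\tfrac12;z\right)=\Big(\frac{(2\alpha)_m}{m!}\Big)^3\sum_{n=0}^\infty v_n z^n,$$ where $v_0=1$, $v_1=-6m(2\alpha+m)/(2\alpha+1)$, $v_2=\frac{3m^2(2\alpha+m)^2}{(\alpha+\frac12)^2}+\frac{6(m-1)m(2\alpha+m+1)(2\alpha+m)}{(2\alpha+1)(2\alpha+3)}$ and, for all $n\ge 2$, $$D(n)\,v_{n+1}=N_0(n)v_n+N_1(n)v_{n-1}+N_2(n)v_{n-2},\qquad D(n)=(n+1)(2\alpha+n)(2\alpha+2n+1)(6\alpha+2n-1),$$ (equivalently, $v_{n+1}$ is given by dividing by $D(n)$, which is nonzero), where $$\begin{aligned}N_0(n)={}&12n^4+24(4\alpha-1)n^3+\big(4\alpha(55\alpha-29)-40m^2-80\alpha m+19\big)n^2\\&+\big((4\alpha-1)(4\alpha(9\alpha-5)+5)+20(1-6\alpha)m^2+40\alpha(1-6\alpha)m\big)n-12\alpha(6\alpha-1)m(2\alpha+m),\end{aligned}$$ $$\begin{aligned}N_1(n)={}&-12n^4+(60-120\alpha)n^3+4\big(-88\alpha^2+108\alpha+20m^2+40\alpha m-29\big)n^2\\&+6(2\alpha-1)\big(-24\alpha^2+54\alpha+30m^2+60\alpha m-17\big)n\\&+288\alpha^3-440\alpha^2+216\alpha-36m^4-144\alpha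 m^3+144\alpha^2m^2-360\alpha m^2\\&+100m^2+576\alpha^3m-720\alpha^2m+200\alpha m-34,\end{aligned}$$ $$N_2(n)=4(3m-n+2)(-2\alpha+m-n+2)(4\alpha+m+n-2)(6\alpha+3m+n-2).$$
   Context: $C_m^{(\alpha)}$ is the Gegenbauer polynomial, with generating function $(1-2xt+t^2)^{-\alpha}=\sum_{m\ge0}C_m^{(\alpha)}(x)t^m$. $F(a,b;c;z)=\sum_{k=0}^\infty \frac{(a)_k(b)_k}{(c)_k\,k!}z^k$, $|z|<1$, is the Gaussian hypergeometric function, with $(x)_k=x(x+1)\cdots(x+k-1)$, $(x)_0=1$; $F^3$ denotes its cube. *)

theory Defs
  imports "HOL-Complex_Analysis.Complex_Analysis"
begin

(* Coefficient of t^m in the Taylor expansion at t = 0 of (1 - 2 x t + t^2)^(-\<alpha>).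
   The base equals 1 at t = 0, so the principal branch is analytic near t = 0. *)
definition gegenbauer :: "nat \<Rightarrow> real \<Rightarrow> complex \<Rightarrow> complex" where
  "gegenbauer m \<alpha> x =
     fps_nth (fps_expansion (\<lambda>t. (1 - 2 * x * t + t ^ 2) powr (- of_real \<alpha>)) 0) m"

lemma gegenbauer_generating_function:
  "(\<lambda>t. (1 - 2 * x * t + t ^ 2) powr (- of_real \<alpha>)) has_fps_expansion
     Abs_fps (\<lambda>m. gegenbauer m \<alpha> x)"
proof -
  have "(\<lambda>t. (1 - 2 * x * t + t ^ 2) powr (- of_real \<alpha>)) analytic_on {0}"
    by (intro analytic_intros) auto
  then have "(\<lambda>t. (1 - 2 * x * t + t ^ 2) powr (- of_real \<alpha>)) has_fps_expansion
      fps_expansion (\<lambda>t. (1 - 2 * x * t + t ^ 2) powr (- of_real \<alpha>)) 0"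
    by (rule analytic_at_imp_has_fps_expansion_0)
  then show ?thesis
    unfolding gegenbauer_def fps_nth_inverse .
qed

(* Only meaningful where the series converges: |z| < 1, or a terminating series. *)
definition gauss_hypergeo :: "complex \<Rightarrow> complex \<Rightarrow> complex \<Rightarrow> complex \<Rightarrow> complex" where
  "gauss_hypergeo a b c z =
     (\<Sum>k. pochhammer a k * pochhammer b k / (pochhammer c k * fact k) * z ^ k)"

(* recD(n) v(n+1) = recN0(n) v(n) + recN1(n) v(n-1) + recN2(n) v(n-2) for n \<ge> 2 is the recurrence
   of the Taylor coefficients v of the cube of F(-m, m + 2 \<alpha>; \<alpha> + 1/2; z). Real arguments keep
   subtraction from truncating. *)

definition recD :: "real \<Rightarrow> real \<Rightarrow> real" where
  "recD \<alpha> n = (n + 1) * (2 * \<alpha> + n) * (2 * \<alpha> + 2 * n + 1) * (6 * \<alpha> + 2 * n - 1)"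

definition recN0 :: "real \<Rightarrow> real \<Rightarrow> real \<Rightarrow> real" where
  "recN0 \<alpha> m n =
     12 * n ^ 4 + 24 * (4 * \<alpha> - 1) * n ^ 3
     + (4 * \<alpha> * (55 * \<alpha> - 29) - 40 * m ^ 2 - 80 * \<alpha> * m + 19) * n ^ 2
     + ((4 * \<alpha> - 1) * (4 * \<alpha> * (9 * \<alpha> - 5) + 5) + 20 * (1 - 6 * \<alpha>) * m ^ 2
        + 40 * \<alpha> * (1 - 6 * \<alpha>) * m) * n
     - 12 * \<alpha> * (6 * \<alpha> - 1) * m * (2 * \<alpha> + m)"

definition recN1 :: "real \<Rightarrow> real \<Rightarrow> real \<Rightarrow> real" where
  "recN1 \<alpha> m n =
     - 12 * n ^ 4 + (60 - 120 * \<alpha>) * n ^ 3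
     + 4 * (- 88 * \<alpha> ^ 2 + 108 * \<alpha> + 20 * m ^ 2 + 40 * \<alpha> * m - 29) * n ^ 2
     + 6 * (2 * \<alpha> - 1) * (- 24 * \<alpha> ^ 2 + 54 * \<alpha> + 30 * m ^ 2 + 60 * \<alpha> * m - 17) * n
     + 288 * \<alpha> ^ 3 - 440 * \<alpha> ^ 2 + 216 * \<alpha> - 36 * m ^ 4 - 144 * \<alpha> * m ^ 3
     + 144 * \<alpha> ^ 2 * m ^ 2 - 360 * \<alpha> * m ^ 2
     + 100 * m ^ 2 + 576 * \<alpha> ^ 3 * m - 720 * \<alpha> ^ 2 * m + 200 * \<alpha> * m - 34"

definition recN2 :: "real \<Rightarrow> real \<Rightarrow> real \<Rightarrow> real" where
  "recN2 \<alpha> m n =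
     4 * (3 * m - n + 2) * (- 2 * \<alpha> + m - n + 2) * (4 * \<alpha> + m + n - 2)
       * (6 * \<alpha> + 3 * m + n - 2)"

end

theory Submission
  imports Defs
begin

text \<open>
  Write \<open>a = -m\<close>, \<open>b = m + 2\<alpha>\<close>, \<open>c = \<alpha> + 1/2\<close>. These parameters satisfy \<open>a + b + 1 = 2c\<close>, so
  with \<open>p = X(1 - X)\<close> the hypergeometric equation of \<open>f = F(a, b; c; X)\<close> takes the form
  \<open>p f'' + c p' f' = a b f\<close>, in which the coefficient of \<open>f'\<close> is a multiple of \<open>p'\<close>.

  The recurrence says that \<open>w = f\<^sup>3\<close> solves a linear differential equation of order four,
  the symmetric cube of that equation. To find it, note that the products \<open>f\<^sup>3\<close>, \<open>f\<^sup>2 f'\<close>,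
  \<open>f f'\<^sup>2\<close>, \<open>f'\<^sup>3\<close> span, over the rational functions, a space that is closed under differentiation,
  because \<open>p f''\<close> is a combination of \<open>f\<close> and \<open>f'\<close>. Each of them can be reached from \<open>w\<close>:
  one combination of \<open>w\<close>, \<open>w'\<close>, \<open>w''\<close> is \<open>A = 6 p f f'\<^sup>2\<close>, one combination of \<open>A\<close>, \<open>A'\<close>, \<open>w'\<close>
  is \<open>B = 6 p\<^sup>2 f'\<^sup>3\<close>, and then \<open>B'\<close> is a combination of \<open>A\<close> and \<open>B\<close>, which closes the chain
  (\<open>cube_ode\<close>). All coefficients are polynomials in \<open>X\<close> of low degree, so comparing the
  coefficients of \<open>X\<^sup>n\<close> turns each link of the chain into a short relation between the coefficient
  sequences of \<open>w\<close>, \<open>A\<close> and \<open>B\<close>; eliminating \<open>A\<close> and \<open>B\<close> leaves the four-term recurrence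
  (\<open>cube_coeff_recurrence\<close>).

  For the link with Gegenbauer polynomials, the generating function \<open>g(t) = (1 - 2xt + t\<^sup>2)\<^sup>-\<^sup>\<alpha>\<close>
  satisfies \<open>(1 - 2xt + t\<^sup>2) g' = 2\<alpha>(x - t) g\<close>, which is the classical three-term recurrence in \<open>m\<close>.
  At \<open>x = 1 - 2z\<close> the polynomials \<open>(2\<alpha>)\<^sub>m/m! F(-m, m + 2\<alpha>; \<alpha> + 1/2; z)\<close> satisfy
  the same recurrence coefficient by coefficient and have the same first two members.
  Since the series of \<open>F\<close> terminates, its radius of convergence is infinite, and evaluation of
  formal power series commutes with all operations involved.
\<close>

unbundle no vec_syntax

section \<open>The symmetric cube of the hypergeometric equation\<close>

text \<open>
  \<open>A\<close> and \<open>B\<close> are chosen so that the equation for \<open>f\<close> makes them equal to \<open>6 p f f'\<^sup>2\<close> and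
  \<open>6 p\<^sup>2 f'\<^sup>3\<close>. Keeping them as abbreviations, instead of expanding to a single operator of order
  four, makes every step linear in the equation for \<open>f\<close>.
\<close>

lemma cube_ode:
  fixes f :: "'a :: idom fps" and c q :: 'a
  defines "p \<equiv> fps_X * (1 - fps_X)" and "u \<equiv> 1 - 2 * fps_X"
  defines "w \<equiv> f ^ 3"
  defines "A \<equiv> p * fps_deriv (fps_deriv w) + fps_const c * u * fps_deriv w - 3 * fps_const q * w"
  defines "B \<equiv> p * fps_deriv A + (2 * fps_const c - 1) * u * A - 4 * fps_const q * p * fps_deriv w"
  assumes ode: "p * fps_deriv (fps_deriv f) + fps_const c * u * fps_deriv f = fps_const q * f"
  shows "p * fps_deriv B + (3 * fps_const c - 2) * u * B - 3 * fps_const q * p * A = 0"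
proof -
  define f1 where "f1 = fps_deriv f"
  define f2 where "f2 = fps_deriv f1"
  have p': "fps_deriv p = u"
    by (simp add: p_def u_def algebra_simps)
  have ode': "p * f2 + fps_const c * u * f1 = fps_const q * f"
    using ode by (simp add: f1_def f2_def)
  have w1: "fps_deriv w = 3 * f ^ 2 * f1"
    by (simp add: w_def f1_def fps_deriv_power algebra_simps power2_eq_square power3_eq_cube)
  have w2: "fps_deriv (fps_deriv w) = 6 * f * f1 ^ 2 + 3 * f ^ 2 * f2"
    unfolding w1 by (simp add: f2_def f1_def algebra_simps power2_eq_square)
  have A: "A = 6 * p * f * f1 ^ 2"
    unfolding A_def w2 unfolding w1 unfolding w_def using ode' by algebra
  have A1: "fps_deriv A = 6 * u * f * f1 ^ 2 + 6 * p * f1 ^ 3 + 12 * p * f * f1 * f2"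
    unfolding A by (simp add: p' f2_def f1_def algebra_simps power2_eq_square power3_eq_cube)
  have B: "B = 6 * p ^ 2 * f1 ^ 3"
    unfolding B_def A1 unfolding A w1 using ode' by algebra
  have B1: "fps_deriv B = 12 * p * u * f1 ^ 3 + 18 * p ^ 2 * f1 ^ 2 * f2"
    unfolding B by (simp add: p' f2_def f1_def algebra_simps power2_eq_square power3_eq_cube)
  show ?thesis
    unfolding B1 unfolding B A using ode' by algebra
qed

definition hypergeo_fps :: "'a::field_char_0 \<Rightarrow> 'a \<Rightarrow> 'a \<Rightarrow> 'a fps" where
  "hypergeo_fps a b c =
     Abs_fps (\<lambda>k. pochhammer a k * pochhammer b k / (pochhammer c k * fact k))"

lemma hypergeo_fps_nth_Suc:
  fixes c :: "'a::field_char_0"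
  assumes "\<And>k. c + of_nat k \<noteq> 0"
  shows "of_nat (Suc k) * (c + of_nat k) * hypergeo_fps a b c $ Suc k =
    (a + of_nat k) * (b + of_nat k) * hypergeo_fps a b c $ k"
proof -
  have "(1::'a) + of_nat k \<noteq> 0" by (metis of_nat_Suc of_nat_neq_0)
  moreover have "pochhammer c k \<noteq> 0"
    using assms by (auto simp: pochhammer_eq_0_iff add_eq_0_iff2)
  ultimately show ?thesis
    using assms[of k]
    by (simp add: hypergeo_fps_def pochhammer_rec' divide_simps)
qed

text \<open>
  In general the coefficient of \<open>f'\<close> in the hypergeometric equation is \<open>c - (a + b + 1) X\<close>;
  the assumption on the parameters makes it proportional to the derivative of \<open>X(1 - X)\<close>.
\<close>

lemma hypergeo_fps_ode:
  fixes c :: "'a::field_char_0"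
  assumes "\<And>k. c + of_nat k \<noteq> 0" and "a + b + 1 = 2 * c"
  defines "f \<equiv> hypergeo_fps a b c"
  shows "fps_X * (1 - fps_X) * fps_deriv (fps_deriv f) + fps_const c * (1 - 2 * fps_X) * fps_deriv f
    = fps_const (a * b) * f"
proof (rule fps_ext)
  fix n
  have *: "fps_X * (1 - fps_X) * fps_deriv (fps_deriv f) + fps_const c * (1 - 2 * fps_X) * fps_deriv f
    = fps_X * fps_deriv (fps_deriv f) - fps_X * (fps_X * fps_deriv (fps_deriv f))
      + fps_const c * fps_deriv f - fps_const (2 * c) * (fps_X * fps_deriv f)"
    by (simp add: algebra_simps numeral_fps_const flip: fps_const_mult)
  have ab: "2 * c = a + b + 1" using assms(2) by simp
  show "(fps_X * (1 - fps_X) * fps_deriv (fps_deriv f)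
      + fps_const c * (1 - 2 * fps_X) * fps_deriv f) $ n = (fps_const (a * b) * f) $ n"
  proof (cases n)
    case 0
    then show ?thesis
      unfolding * using hypergeo_fps_nth_Suc[OF assms(1), of 0 a b]
      by (simp add: f_def mult.assoc)
  next
    case (Suc k)
    have "of_nat (k + 2) * (c + of_nat (k + 1)) * f $ (k + 2) =
      (a + of_nat (k + 1)) * (b + of_nat (k + 1)) * f $ (k + 1)"
      using hypergeo_fps_nth_Suc[OF assms(1), of "Suc k" a b] by (simp add: f_def)
    then show ?thesis
      unfolding * ab Suc by (cases k) (simp_all add: algebra_simps)
  qed
qed

section \<open>The four-term recurrence\<close>

text \<open>
  The polynomials \<open>recD\<close>, \<open>recN0\<close>, \<open>recN1\<close>, \<open>recN2\<close> arise when the three coefficient relations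
  of \<open>cube_ode\<close> are composed. The leading coefficient comes out as
  \<open>(n + 1) (n + c) (n + 2c - 1) (n + 3c - 2)\<close>, with \<open>c = \<alpha> + 1/2\<close>: the exponents at \<open>0\<close> of the equation for \<open>f\<close> are
  \<open>0\<close> and \<open>1 - c\<close>, hence those of the symmetric cube are \<open>0\<close>, \<open>1 - c\<close>, \<open>2(1 - c)\<close>, \<open>3(1 - c)\<close>. A factor 4 turns
  this product into \<open>recD\<close>.
\<close>

lemma cube_coeff_recurrence:
  fixes f :: "real fps" and \<alpha> m :: real and n :: nat
  assumes ode: "fps_X * (1 - fps_X) * fps_deriv (fps_deriv f)
    + fps_const (\<alpha> + 1 / 2) * (1 - 2 * fps_X) * fps_deriv f
    = fps_const (- m * (m + 2 * \<alpha>)) * f" and n: "n \<ge> 2"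
  defines "v \<equiv> fps_nth (f ^ 3)"
  shows "recD \<alpha> n * v (n + 1) =
    recN0 \<alpha> m n * v n + recN1 \<alpha> m n * v (n - 1) + recN2 \<alpha> m n * v (n - 2)"
proof -
  define c where "c = \<alpha> + 1 / 2"
  define q where "q = - m * (m + 2 * \<alpha>)"
  let ?p = "fps_X * (1 - fps_X :: real fps)" and ?u = "1 - 2 * fps_X :: real fps"
  define w where "w = f ^ 3"
  define A where "A = ?p * fps_deriv (fps_deriv w) + fps_const c * ?u * fps_deriv w
    - 3 * fps_const q * w"
  define B where "B = ?p * fps_deriv A + (2 * fps_const c - 1) * ?u * A
    - 4 * fps_const q * ?p * fps_deriv w"
  have L: "?p * fps_deriv B + (3 * fps_const c - 2) * ?u * B - 3 * fps_const q * ?p * A = 0"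
    using cube_ode[OF ode] unfolding A_def B_def w_def c_def q_def .
  have const: "fps_const (2 * x) = 2 * fps_const x" "fps_const (3 * x) = 3 * fps_const x"
    "fps_const (4 * x) = 4 * fps_const x" "fps_const (x - 1) = fps_const x - 1"
    "fps_const (x - 2) = fps_const x - 2" for x :: real
    by (simp_all add: numeral_fps_const flip: fps_const_1_eq_1)
  \<comment> \<open>Only multiplications by constants and by \<open>X\<close> remain, so that taking coefficients
    amounts to index shifts.\<close>
  have A': "A = fps_X * fps_deriv (fps_deriv w) - fps_X * (fps_X * fps_deriv (fps_deriv w))
    + fps_const c * fps_deriv w - fps_const (2 * c) * (fps_X * fps_deriv w) - fps_const (3 * q) * w"
    unfolding A_def const by algebra
  have B': "B = fps_X * fps_deriv A - fps_X * (fps_X * fps_deriv A)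
    + fps_const (2 * c - 1) * A - fps_const (2 * (2 * c - 1)) * (fps_X * A)
    - fps_const (4 * q) * (fps_X * fps_deriv w) + fps_const (4 * q) * (fps_X * (fps_X * fps_deriv w))"
    unfolding B_def const by algebra
  have L': "0 = fps_X * fps_deriv B - fps_X * (fps_X * fps_deriv B)
    + fps_const (3 * c - 2) * B - fps_const (2 * (3 * c - 2)) * (fps_X * B)
    - fps_const (3 * q) * (fps_X * A) + fps_const (3 * q) * (fps_X * (fps_X * A))"
    unfolding L[symmetric] const by algebra
  have A_nth: "A $ k = (k + 1) * (k + c) * v (k + 1) - (k * (k - 1) + 2 * c * k + 3 * q) * v k" for k
  proof (cases k)
    case (Suc j)
    then show ?thesis
      unfolding A' v_def w_def[symmetric] by (cases j) (simp_all add: algebra_simps)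
  qed (simp add: A' v_def w_def[symmetric])
  have B_nth: "B $ (k + 1) = (k + 2 * c) * A $ (k + 1) - (k + 2 * (2 * c - 1)) * A $ k
    - 4 * q * ((k + 1) * v (k + 1) - k * v k)" for k
    unfolding B' v_def w_def[symmetric] by (cases k; simp; simp add: algebra_simps)
  have L_nth: "0 = (k + 3 * c) * B $ (k + 2) - (k + 1 + 2 * (3 * c - 2)) * B $ (k + 1)
    - 3 * q * (A $ (k + 1) - A $ k)" for k
    using L'[THEN arg_cong[where f = "\<lambda>F. F $ (k + 2)"]] by (simp, simp add: algebra_simps)
  obtain k where k: "n = k + 2" using n by (metis le_add_diff_inverse2)
  have eq: "0 = 4 * ((k + 3 * c) * B $ (k + 1 + 1) - (k + 1 + 2 * (3 * c - 2)) * B $ (k + 1)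
    - 3 * q * (A $ (k + 1) - A $ k))"
    using L_nth[of k] by simp
  have ix: "v (k + 1 + 1 + 1) = v (k + 3)" "v (k + 1 + 1) = v (k + 2)" "v (n + 1) = v (k + 3)"
    "v n = v (k + 2)" "v (n - 1) = v (k + 1)" "v (n - 2) = v k" "real n = real k + 2"
    "real (k + 1) = real k + 1" "real (k + 1 + 1) = real k + 2"
    by (simp_all add: k numeral_3_eq_3)
  show ?thesis
    using eq unfolding B_nth unfolding A_nth unfolding ix
    unfolding recD_def recN0_def recN1_def recN2_def q_def c_def
    by algebra
qed

lemma hypergeo_fps_cube_recurrence:
  fixes \<alpha> m :: real and n :: nat
  assumes "\<alpha> > 0" and "n \<ge> 2"
  defines "v \<equiv> fps_nth (hypergeo_fps (- m) (m + 2 * \<alpha>) (\<alpha> + 1 / 2) ^ 3)"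
  shows "recD \<alpha> n * v (n + 1) =
    recN0 \<alpha> m n * v n + recN1 \<alpha> m n * v (n - 1) + recN2 \<alpha> m n * v (n - 2)"
proof -
  have "\<alpha> + 1 / 2 + real k \<noteq> 0" for k
    using assms(1) by (smt (verit) of_nat_0_le_iff field_sum_of_halves)
  then show ?thesis
    unfolding v_def using assms(2)
    by (intro cube_coeff_recurrence hypergeo_fps_ode) simp_all
qed

section \<open>Convergence and evaluation\<close>

text \<open>
  The coefficients \<open>v n\<close> are real while the series is evaluated at complex points; this moves
  between the two.
\<close>

lemma fps_power_nth_of_real:
  fixes f :: "real fps" and g :: "'a::{real_algebra_1, comm_ring_1} fps"
  assumes "\<And>n. g $ n = of_real (f $ n)"
  shows "(g ^ k) $ n = of_real ((f ^ k) $ n)"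
  by (induction k arbitrary: n) (simp_all add: fps_mult_nth assms)

lemma fps_conv_radius_hypergeo_fps_terminating:
  fixes b c :: "'a::{banach, real_normed_field}"
  shows "fps_conv_radius (hypergeo_fps (- of_nat m) b c) = \<infinity>"
proof -
  have "eventually (\<lambda>k. hypergeo_fps (- of_nat m) b c $ k = 0) sequentially"
    using eventually_gt_at_top[of m]
    by eventually_elim (auto simp: hypergeo_fps_def pochhammer_of_nat_eq_0_iff)
  then have "conv_radius (fps_nth (hypergeo_fps (- of_nat m) b c)) = conv_radius (\<lambda>_. 0 :: 'a)"
    by (rule conv_radius_cong')
  then show ?thesis by (simp add: fps_conv_radius_def)
qed

lemma gauss_hypergeo_eq_eval_fps: "gauss_hypergeo a b c z = eval_fps (hypergeo_fps a b c) z"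
  by (simp add: gauss_hypergeo_def eval_fps_def hypergeo_fps_def)

section \<open>Gegenbauer polynomials as hypergeometric polynomials\<close>

text \<open>
  Logarithmic differentiation of the generating function. It is legitimate near \<open>0\<close>, where
  the base stays in the disc of radius 1 about 1 and thus away from the branch cut.
\<close>

lemma gegenbauer_ode:
  fixes \<alpha> :: real and x :: complex
  defines "G \<equiv> Abs_fps (\<lambda>m. gegenbauer m \<alpha> x)"
  shows "(1 - fps_const (2 * x) * fps_X + fps_X ^ 2) * fps_deriv G
    = fps_const (2 * of_real \<alpha>) * (fps_const x - fps_X) * G"
proof -
  define b where "b = (\<lambda>t. 1 - 2 * x * t + t ^ 2 :: complex)"
  define g where "g = (\<lambda>t. b t powr (- of_real \<alpha>))"
  have g: "g has_fps_expansion G"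
    unfolding g_def b_def G_def by (rule gegenbauer_generating_function)
  have "continuous_on UNIV b"
    unfolding b_def by (intro continuous_intros)
  then have "open (b -` ball 1 1)"
    by (intro open_vimage) auto
  then have ev: "eventually (\<lambda>t. t \<in> b -` ball 1 1) (nhds 0)"
    by (rule eventually_nhds_in_open) (simp add: b_def)
  have eq: "b t * deriv g t = 2 * of_real \<alpha> * (x - t) * g t" if t: "t \<in> b -` ball 1 1" for t
  proof -
    have "Re (b t) > 0"
      using t abs_Re_le_cmod[of "1 - b t"] by (simp add: dist_norm)
    then have b: "b t \<notin> \<real>\<^sub>\<le>\<^sub>0"
      by (simp add: complex_nonpos_Reals_iff)
    then have "b t \<noteq> 0" by auto
    have "(b has_field_derivative 2 * (t - x)) (at t)"
      unfolding b_def by (auto intro!: derivative_eq_intros)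
    then have "(g has_field_derivative
        - of_real \<alpha> * b t powr (- of_real \<alpha> - 1) * (2 * (t - x))) (at t)"
      unfolding g_def using b by (auto intro!: derivative_eq_intros)
    then have "deriv g t = - of_real \<alpha> * b t powr (- of_real \<alpha> - 1) * (2 * (t - x))"
      by (rule DERIV_imp_deriv)
    moreover have "b t powr (- of_real \<alpha> - 1) * b t = g t"
      unfolding g_def using \<open>b t \<noteq> 0\<close> by (simp add: powr_diff)
    ultimately show ?thesis by algebra
  qed
  have "(\<lambda>t. b t * deriv g t) has_fps_expansion
      (1 - fps_const (2 * x) * fps_X + fps_X ^ 2) * fps_deriv G"
    unfolding b_def by (intro fps_expansion_intros g)
  then have "(\<lambda>t. 2 * of_real \<alpha> * (x - t) * g t) has_fps_expansion
      (1 - fps_const (2 * x) * fps_X + fps_X ^ 2) * fps_deriv G"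
    by (rule has_fps_expansion_cong[THEN iffD1, rotated -1])
      (use ev in eventually_elim, auto simp: eq)
  moreover have "(\<lambda>t. 2 * of_real \<alpha> * (x - t) * g t) has_fps_expansion
      fps_const (2 * of_real \<alpha>) * (fps_const x - fps_X) * G"
    by (intro fps_expansion_intros g)
  ultimately show ?thesis by (rule fps_expansion_unique_complex)
qed

lemma gegenbauer_0: "gegenbauer 0 \<alpha> x = 1"
  using has_fps_expansion_imp_0_eq_fps_nth_0[OF gegenbauer_generating_function[of x \<alpha>]] by simp

lemma gegenbauer_1: "gegenbauer (Suc 0) \<alpha> x = 2 * of_real \<alpha> * x"
  using gegenbauer_ode[of x \<alpha>, THEN arg_cong[where f = "\<lambda>F. F $ 0"]]
  by (simp add: gegenbauer_0)

lemma gegenbauer_Suc_Suc: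
  "of_nat (m + 2) * gegenbauer (m + 2) \<alpha> x =
    2 * (of_nat (m + 1) + of_real \<alpha>) * x * gegenbauer (m + 1) \<alpha> x
    - (of_nat m + 2 * of_real \<alpha>) * gegenbauer m \<alpha> x"
proof -
  define G where "G = Abs_fps (\<lambda>m. gegenbauer m \<alpha> x)"
  have "fps_deriv G - fps_const (2 * x) * (fps_X * fps_deriv G) + fps_X * (fps_X * fps_deriv G)
    = fps_const (2 * of_real \<alpha> * x) * G - fps_const (2 * of_real \<alpha>) * (fps_X * G)"
    using gegenbauer_ode[of x \<alpha>]
    unfolding G_def[symmetric] fps_const_mult[symmetric] by algebra
  then have "(fps_deriv G - fps_const (2 * x) * (fps_X * fps_deriv G)
      + fps_X * (fps_X * fps_deriv G)) $ (m + 1)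
    = (fps_const (2 * of_real \<alpha> * x) * G - fps_const (2 * of_real \<alpha>) * (fps_X * G)) $ (m + 1)"
    by simp
  then show ?thesis
    by (cases m) (simp_all add: G_def algebra_simps)
qed

definition gegenbauer_fps :: "nat \<Rightarrow> 'a::field_char_0 \<Rightarrow> 'a fps" where
  "gegenbauer_fps m a =
    fps_const (pochhammer (2 * a) m / fact m) * hypergeo_fps (- of_nat m) (of_nat m + 2 * a) (a + 1 / 2)"

text \<open>
  This form of the coefficients keeps \<open>m\<close> only in a binomial coefficient, a factorial and one
  Pochhammer symbol of index \<open>m + k\<close>, so that neighbouring values of \<open>m\<close> and \<open>k\<close> have rational
  quotients.
\<close>

lemma gegenbauer_fps_nth:
  "gegenbauer_fps m a $ k =
    (-1) ^ k * of_nat (m choose k) * pochhammer (2 * a) (m + k) / (fact m * pochhammer (a + 1 / 2) k)"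
proof -
  have "pochhammer (- of_nat m :: 'a) k = (-1) ^ k * of_nat (m choose k) * fact k"
    unfolding binomial_gbinomial gbinomial_pochhammer by (simp flip: power_mult_distrib)
  then show ?thesis
    by (simp add: gegenbauer_fps_def hypergeo_fps_def pochhammer_product'[of "2 * a" m k]
        add.commute[of "of_nat m"])
qed

text \<open>
  The subtraction takes place in the ring, which makes the identity hold without a bound on \<open>i\<close>.
\<close>

lemma of_nat_choose_absorb:
  "of_nat (n + 1) * of_nat (n choose i) =
    (of_nat (n + 1) - of_nat i :: 'a::comm_ring_1) * of_nat (n + 1 choose i)"
proof (cases "i \<le> n + 1")
  case True
  then show ?thesis
    using binomial_absorb_comp[of "n + 1" i]
    by (metis add_diff_cancel_right' of_nat_diff of_nat_mult)
qed (simp add: binomial_eq_0)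

text \<open>
  The recurrence of \<open>gegenbauer_Suc_Suc\<close> at \<open>x = 1 - 2X\<close>. For \<open>k > 0\<close> all four coefficients are
  multiples of one term \<open>T\<close>, with \<open>m + 2 choose k\<close> as the binomial coefficient; taking the largest
  upper index avoids division by \<open>m - k\<close> and hence a case distinction on the degree.
\<close>

lemma gegenbauer_fps_Suc_Suc:
  fixes a :: "'a::field_char_0"
  assumes c: "\<And>k. a + 1 / 2 + of_nat k \<noteq> 0"
  shows "of_nat (m + 2) * gegenbauer_fps (m + 2) a $ k =
    2 * (of_nat (m + 1) + a) * ((1 - 2 * fps_X) * gegenbauer_fps (m + 1) a) $ k
    - (of_nat m + 2 * a) * gegenbauer_fps m a $ k"
proof -
  let ?M = "of_nat m :: 'a"
  have M: "?M + 1 \<noteq> 0" "?M + 2 \<noteq> 0"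
    by (metis of_nat_Suc of_nat_neq_0 add.commute,
      metis of_nat_add of_nat_numeral of_nat_neq_0 add_2_eq_Suc')
  have fact: "fact (m + 1) = (?M + 1) * fact m" "fact (m + 2) = (?M + 2) * (?M + 1) * fact m"
    by (simp_all add: add_ac)
  have split: "((1 - 2 * fps_X) * gegenbauer_fps (m + 1) a) $ k =
      gegenbauer_fps (m + 1) a $ k - 2 * (if k = 0 then 0 else gegenbauer_fps (m + 1) a $ (k - 1))"
    by (simp add: left_diff_distrib mult.assoc numeral_fps_const)
  show ?thesis
  proof (cases k)
    case 0
    have "pochhammer (2 * a) (m + 1) = (2 * a + ?M) * pochhammer (2 * a) m"
      "pochhammer (2 * a) (m + 2) = (2 * a + ?M + 1) * (2 * a + ?M) * pochhammer (2 * a) m"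
      by (simp_all add: pochhammer_rec' add_ac)
    then show ?thesis
      unfolding split gegenbauer_fps_nth fact using M
      by (simp add: 0 divide_simps) (simp add: algebra_simps)
  next
    case (Suc j)
    let ?J = "of_nat j :: 'a"
    define N where "N = (of_nat (m + 2 choose (j + 1)) :: 'a)"
    have N1: "of_nat (m + 1 choose (j + 1)) = (?M + 1 - ?J) * N / (?M + 2)"
      using of_nat_choose_absorb[of "m + 1" "j + 1", where 'a = 'a] M
      by (simp add: N_def field_simps del: binomial_Suc_Suc)
    have N2: "of_nat (m choose (j + 1)) = (?M - ?J) * (?M + 1 - ?J) * N / ((?M + 2) * (?M + 1))"
    proof -
      have "of_nat (m choose (j + 1)) = (?M - ?J) * of_nat (m + 1 choose (j + 1)) / (?M + 1)"
        using of_nat_choose_absorb[of m "j + 1", where 'a = 'a] M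
        by (simp add: field_simps del: binomial_Suc_Suc)
      then show ?thesis unfolding N1 by simp
    qed
    have N3: "of_nat (m + 1 choose j) = (?J + 1) * N / (?M + 2)"
    proof -
      have "(?J + 1) * of_nat (m + 2 choose (j + 1)) = (?M + 2) * of_nat (m + 1 choose j)"
        using Suc_times_binomial[of j "m + 1", THEN arg_cong[where f = "of_nat :: nat \<Rightarrow> 'a"]]
        by (simp add: algebra_simps del: binomial_Suc_Suc)
      then show ?thesis using M by (simp add: N_def field_simps del: binomial_Suc_Suc)
    qed
    define P where "P = pochhammer (2 * a) (m + j + 1)"
    have P: "pochhammer (2 * a) (m + 2 + (j + 1)) = (2 * a + ?M + ?J + 2) * (2 * a + ?M + ?J + 1) * P"
      "pochhammer (2 * a) (m + 1 + (j + 1)) = (2 * a + ?M + ?J + 1) * P"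
      "pochhammer (2 * a) (m + 1 + j) = P" "pochhammer (2 * a) (m + (j + 1)) = P"
      using pochhammer_rec'[of "2 * a" "m + j + 1"] pochhammer_rec'[of "2 * a" "m + j + 2"]
      by (simp_all add: P_def add_ac numeral_2_eq_2)
    define Q where "Q = pochhammer (a + 1 / 2) j"
    have Q: "pochhammer (a + 1 / 2) (j + 1) = (a + 1 / 2 + ?J) * Q"
      by (simp add: Q_def pochhammer_rec')
    have ix: "k = j + 1" "k - 1 = j" using Suc by simp_all
    define T where "T = (-1) ^ j * N * P / ((?M + 2) * (?M + 1) * fact m * Q)"
    have "gegenbauer_fps (m + 2) a $ k =
        - T * (2 * a + ?M + ?J + 2) * (2 * a + ?M + ?J + 1) / (a + 1 / 2 + ?J)"
      unfolding gegenbauer_fps_nth ix fact P Q N_def[symmetric] T_def by (simp add: mult_ac)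
    moreover have "gegenbauer_fps (m + 1) a $ k =
        - T * (?M + 1 - ?J) * (2 * a + ?M + ?J + 1) / (a + 1 / 2 + ?J)"
      unfolding gegenbauer_fps_nth ix fact P Q N1 T_def by (simp add: mult_ac)
    moreover have "gegenbauer_fps (m + 1) a $ (k - 1) = T * (?J + 1)"
      unfolding ix(2) gegenbauer_fps_nth fact P Q_def[symmetric] N3 T_def by (simp add: mult_ac)
    moreover have "gegenbauer_fps m a $ k =
        - T * (?M - ?J) * (?M + 1 - ?J) / (a + 1 / 2 + ?J)"
      unfolding gegenbauer_fps_nth ix P Q N2 T_def by (simp add: mult_ac)
    moreover have "of_nat (m + 2)
        * (- T * (2 * a + ?M + ?J + 2) * (2 * a + ?M + ?J + 1) / (a + 1 / 2 + ?J))
      = 2 * (of_nat (m + 1) + a) * (- T * (?M + 1 - ?J) * (2 * a + ?M + ?J + 1) / (a + 1 / 2 + ?J)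
          - 2 * (T * (?J + 1)))
        - (of_nat m + 2 * a) * (- T * (?M - ?J) * (?M + 1 - ?J) / (a + 1 / 2 + ?J))"
    proof -
      define d where "d = a + 1 / 2 + ?J"
      have "d \<noteq> 0" using c by (simp add: d_def)
      moreover have a: "a = d - 1 / 2 - ?J" by (simp add: d_def)
      ultimately show ?thesis
        unfolding d_def[symmetric] unfolding a
        by (simp add: divide_simps) algebra
    qed
    ultimately show ?thesis unfolding split by (simp add: ix)
  qed
qed

lemma gegenbauer_eq_eval_fps:
  assumes "\<alpha> > 0"
  shows "gegenbauer m \<alpha> (1 - 2 * z) = eval_fps (gegenbauer_fps m (of_real \<alpha>)) z"
proof -
  let ?H = "\<lambda>m. gegenbauer_fps m (complex_of_real \<alpha>)"
  have c: "complex_of_real \<alpha> + 1 / 2 + of_nat k \<noteq> 0" for k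
  proof -
    have "complex_of_real \<alpha> + 1 / 2 + of_nat k = of_real (\<alpha> + 1 / 2 + k)" by simp
    then show ?thesis using assms by (simp only: of_real_eq_0_iff)
  qed
  have radius_mult: "fps_conv_radius (f * g) = \<infinity>"
    if "fps_conv_radius f = \<infinity>" "fps_conv_radius g = \<infinity>" for f g :: "complex fps"
    using fps_conv_radius_mult[of f g] that by simp
  have radius_lin: "fps_conv_radius (1 - 2 * fps_X :: complex fps) = \<infinity>"
    using fps_conv_radius_diff[of 1 "2 * fps_X :: complex fps"]
    by (simp add: radius_mult numeral_fps_const)
  have radius: "fps_conv_radius (?H m) = \<infinity>" for m
    unfolding gegenbauer_fps_def
    by (simp add: radius_mult fps_conv_radius_hypergeo_fps_terminating)
  have eval_lin: "eval_fps (1 - 2 * fps_X) z = 1 - 2 * z"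
    by (simp add: eval_fps_mult eval_fps_diff radius_mult numeral_fps_const)
  show ?thesis
  proof (induction m rule: induct_nat_012)
    case 0
    have "?H 0 = 1"
      by (rule fps_ext) (simp add: gegenbauer_fps_nth)
    then show ?case by (simp add: gegenbauer_0)
  next
    case 1
    have "?H 1 = fps_const (2 * of_real \<alpha>) * (1 - 2 * fps_X)"
    proof (rule fps_ext)
      fix k
      show "?H 1 $ k = (fps_const (2 * of_real \<alpha>) * (1 - 2 * fps_X)) $ k"
        using c[of 0]
        by (cases "k = 0 \<or> k = 1")
          (auto simp: gegenbauer_fps_nth binomial_eq_0 numeral_fps_const field_simps pochhammer_rec')
    qed
    then show ?case
      by (simp add: gegenbauer_1 eval_fps_mult eval_lin radius_lin)
  next
    case (ge2 m)
    have "fps_const (of_nat (m + 2)) * ?H (m + 2) =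
      fps_const (2 * (of_nat (m + 1) + of_real \<alpha>)) * ((1 - 2 * fps_X) * ?H (m + 1))
      - fps_const (of_nat m + 2 * of_real \<alpha>) * ?H m"
      using gegenbauer_fps_Suc_Suc[OF c, of m] by (intro fps_ext) simp
    then have "eval_fps (fps_const (of_nat (m + 2)) * ?H (m + 2)) z =
      eval_fps (fps_const (2 * (of_nat (m + 1) + of_real \<alpha>)) * ((1 - 2 * fps_X) * ?H (m + 1))
      - fps_const (of_nat m + 2 * of_real \<alpha>) * ?H m) z"
      by simp
    then have "of_nat (m + 2) * eval_fps (?H (m + 2)) z =
      2 * (of_nat (m + 1) + of_real \<alpha>) * (1 - 2 * z) * eval_fps (?H (m + 1)) z
      - (of_nat m + 2 * of_real \<alpha>) * eval_fps (?H m) z"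
      by (simp add: eval_fps_mult eval_fps_diff eval_lin radius radius_lin radius_mult mult.assoc
          del: of_nat_Suc of_nat_add)
    also have "\<dots> = of_nat (m + 2) * gegenbauer (m + 2) \<alpha> (1 - 2 * z)"
      using ge2 gegenbauer_Suc_Suc[of m \<alpha> "1 - 2 * z"] by simp
    finally show ?case
      by (simp del: of_nat_Suc of_nat_add)
  qed
qed

theorem corollary3p5:
  fixes m :: nat and \<alpha> :: real
  assumes "\<alpha> > 0"
  shows "\<exists>v :: nat \<Rightarrow> real.
    v 0 = 1 \<and>
    v 1 = - 6 * real m * (2 * \<alpha> + real m) / (2 * \<alpha> + 1) \<and>
    v 2 = 3 * real m ^ 2 * (2 * \<alpha> + real m) ^ 2 / (\<alpha> + 1 / 2) ^ 2
          + 6 * (real m - 1) * real m * (2 * \<alpha> + real m + 1) * (2 * \<alpha> + real m)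
            / ((2 * \<alpha> + 1) * (2 * \<alpha> + 3)) \<and>
    (\<forall>n\<ge>2. recD \<alpha> (real n) \<noteq> 0 \<and>
       recD \<alpha> (real n) * v (n + 1) =
         recN0 \<alpha> (real m) (real n) * v n
         + recN1 \<alpha> (real m) (real n) * v (n - 1)
         + recN2 \<alpha> (real m) (real n) * v (n - 2)) \<and>
    (\<forall>z :: complex. norm z < 1 \<longrightarrow>
       gegenbauer m \<alpha> (1 - 2 * z) ^ 3 =
         of_real (pochhammer (2 * \<alpha>) m / fact m) ^ 3
         * gauss_hypergeo (- of_nat m) (of_nat m + 2 * of_real \<alpha>) (of_real \<alpha> + 1 / 2) z ^ 3 \<and>
       summable (\<lambda>n. of_real (v n) * z ^ n) \<and>
       of_real (pochhammer (2 * \<alpha>) m / fact m) ^ 3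
         * gauss_hypergeo (- of_nat m) (of_nat m + 2 * of_real \<alpha>) (of_real \<alpha> + 1 / 2) z ^ 3 =
         of_real (pochhammer (2 * \<alpha>) m / fact m) ^ 3 * (\<Sum>n. of_real (v n) * z ^ n))"
proof -
  define f where "f = hypergeo_fps (- real m) (real m + 2 * \<alpha>) (\<alpha> + 1 / 2)"
  define F where
    "F = hypergeo_fps (- of_nat m :: complex) (of_nat m + 2 * of_real \<alpha>) (of_real \<alpha> + 1 / 2)"
  define v where "v = fps_nth (f ^ 3)"
  have F_nth: "F $ n = of_real (f $ n)" for n
    by (simp add: F_def f_def hypergeo_fps_def flip: pochhammer_of_real)
  have F3_nth: "(F ^ 3) $ n = of_real (v n)" for n
    unfolding v_def by (rule fps_power_nth_of_real[OF F_nth])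
  have radius: "fps_conv_radius F = \<infinity>" "fps_conv_radius (F ^ 3) = \<infinity>"
    using fps_conv_radius_power[of F 3]
    by (simp_all add: F_def fps_conv_radius_hypergeo_fps_terminating)
  have hyp: "gauss_hypergeo (- of_nat m) (of_nat m + 2 * of_real \<alpha>) (of_real \<alpha> + 1 / 2) z
    = eval_fps F z" for z
    by (simp add: gauss_hypergeo_eq_eval_fps F_def)
  have f0: "f $ 0 = 1" and f1: "f $ 1 = - (m * (m + 2 * \<alpha>)) / (\<alpha> + 1 / 2)"
    and f2: "f $ 2 = m * (real m - 1) * (m + 2 * \<alpha>) * (m + 2 * \<alpha> + 1)
      / ((\<alpha> + 1 / 2) * (\<alpha> + 3 / 2) * 2)"
    by (simp_all add: f_def hypergeo_fps_def numeral_2_eq_2 pochhammer_rec' fact_Suc algebra_simps)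
  have v0: "v 0 = 1" and v1: "v 1 = 3 * f $ 1" and v2: "v 2 = 3 * (f $ 1) ^ 2 + 3 * f $ 2"
    using f0 by (simp_all add: v_def fps_mult_nth power3_eq_cube numeral_2_eq_2 algebra_simps)
  have d: "\<alpha> + 1 / 2 = (2 * \<alpha> + 1) / 2" "\<alpha> + 3 / 2 = (2 * \<alpha> + 3) / 2"
    "2 * \<alpha> + 1 \<noteq> 0" "2 * \<alpha> + 3 \<noteq> 0"
    using assms by simp_all
  have "recD \<alpha> n \<noteq> 0" if "n \<ge> 2" for n :: nat
    using that assms unfolding recD_def by auto
  moreover have "recD \<alpha> n * v (n + 1) =
      recN0 \<alpha> m n * v n + recN1 \<alpha> m n * v (n - 1) + recN2 \<alpha> m n * v (n - 2)" if "n \<ge> 2" for n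
    unfolding v_def f_def using assms that by (rule hypergeo_fps_cube_recurrence)
  moreover have "v 1 = - 6 * real m * (2 * \<alpha> + real m) / (2 * \<alpha> + 1)"
    unfolding v1 f1 d(1) using d(3) by (simp add: field_simps)
  moreover have "v 2 = 3 * real m ^ 2 * (2 * \<alpha> + real m) ^ 2 / (\<alpha> + 1 / 2) ^ 2
      + 6 * (real m - 1) * real m * (2 * \<alpha> + real m + 1) * (2 * \<alpha> + real m)
        / ((2 * \<alpha> + 1) * (2 * \<alpha> + 3))"
    unfolding v2 f1 f2 d(1,2) using d(3,4)
    by (simp add: power_divide power_mult_distrib add_ac)
  moreover have "gegenbauer m \<alpha> (1 - 2 * z) =
      of_real (pochhammer (2 * \<alpha>) m / fact m) * eval_fps F z" for z
    using assms
    by (simp add: gegenbauer_eq_eval_fps gegenbauer_fps_def eval_fps_mult radius flip: F_def)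
      (simp flip: pochhammer_of_real)
  moreover have "summable (\<lambda>n. of_real (v n) * z ^ n)" for z :: complex
    using summable_fps[of z "F ^ 3"] by (simp add: radius F3_nth)
  moreover have "eval_fps F z ^ 3 = (\<Sum>n. of_real (v n) * z ^ n)" for z
    using eval_fps_power[of z F 3] by (simp add: radius) (simp add: eval_fps_def F3_nth)
  ultimately show ?thesis
    using v0 unfolding hyp by (intro exI[of _ v]) (simp add: power_mult_distrib power_divide)
qed

end
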